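(* For all integers $k,n\ge0$, specializing $p=1-q$, $$T_{0,k,n}(1-q,q)=\sum_{i=0}^k(-1)^i q^{\frac{i(i+1)}{2}}\begin{bmatrix}n-2k+i\\ i\end{bmatrix}_q\left(\binom{n}{k-i}-\binom{n}{k-i-1}\right).$$
   Context: For integers $0\le k\le n$, $\mathrm{Par}(n-k,k)$ is the set of Young diagrams with exactly $k$ rows and $n-k$ columns, empty rows and columns allowed, i.e. of sequences $n-k\ge\lambda_1\ge\dots\ge\lambda_k\ge0$; $n$ is the half-perimeter. French convention: rows are left-justified, the row of length $\lambda_1$ is at the bottom and the rows get weakly shorter going up. A rook placement of shape $\lambda$ is a set of cells of $\lambda$ (those containing a rook) with at most one rook per row and at most one rook per column. A cell containing no rook is said to contain a cross if there is no rook above it in the same column and no rook to its right in the same row. The weight of a rook placement with $r$ rooks and $s$ crosses is $p^rq^s$. $T_{j,k,n}(p,q)\in\mathbb{Z}[p,q]$ is the sum of the weights of all rook placements with shape in $\mathrm{Par}(n-k,k)$ having exactly $j$ rows containing no rook (empty rows count as rows without rook), equivalently having $k-j$ rooks; it is $0$ if there is no such rook placement. $[m]_q=\frac{1-q^m}{1-q}$, $[m]_q!=\prod_{i=1}^m[i]_q$, and $\begin{bmatrix}m\\ i\end{bmatrix}_q=\frac{[m]_q!}{[i]_q![m-i]_q!}$ for $0\le i\le m$, and $0$ otherwise. Ordinary binomial coefficients with negative lower index are $0$. *)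

theory Defs
  imports "HOL-Computational_Algebra.Polynomial"
begin

text \<open>A Young diagram with \<open>b\<close> rows and \<open>a\<close> columns, empty ones allowed, is the list of its
  row lengths from bottom to top. The cell \<open>(r, c)\<close> is in row \<open>r\<close> and column \<open>c\<close>, both counted
  from \<open>0\<close>, so a larger \<open>r\<close> is higher up and a larger \<open>c\<close> is further right.\<close>

definition Par :: "nat \<Rightarrow> nat \<Rightarrow> nat list set" where
  "Par a b = {lam. length lam = b \<and> sorted_wrt (\<ge>) lam \<and> (\<forall>x\<in>set lam. x \<le> a)}"

definition cells :: "nat list \<Rightarrow> (nat \<times> nat) set" where
  "cells lam = {(r, c). r < length lam \<and> c < lam ! r}"

definition rook_placements :: "nat list \<Rightarrow> (nat \<times> nat) set set" where
  "rook_placements lam = {R. R \<subseteq> cells lam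
     \<and> (\<forall>r c c'. (r, c) \<in> R \<longrightarrow> (r, c') \<in> R \<longrightarrow> c = c')
     \<and> (\<forall>r r' c. (r, c) \<in> R \<longrightarrow> (r', c) \<in> R \<longrightarrow> r = r')}"

definition crosses :: "nat list \<Rightarrow> (nat \<times> nat) set \<Rightarrow> (nat \<times> nat) set" where
  "crosses lam R = {(r, c) \<in> cells lam. (r, c) \<notin> R
     \<and> (\<forall>r'>r. (r', c) \<notin> R) \<and> (\<forall>c'>c. (r, c') \<notin> R)}"

definition free_rows :: "nat list \<Rightarrow> (nat \<times> nat) set \<Rightarrow> nat set" where
  "free_rows lam R = {r. r < length lam \<and> (\<forall>c. (r, c) \<notin> R)}"

text \<open>\<open>\<int>[q]\<close> is \<open>int poly\<close>, and \<open>\<int>[p,q]\<close> is \<open>int poly poly\<close>: polynomials in the outer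
  variable \<open>p\<close> with coefficients in \<open>\<int>[q]\<close>. Substituting \<open>f \<in> \<int>[q]\<close> for \<open>p\<close> in \<open>F\<close> is therefore
  \<open>poly F f\<close>.\<close>

abbreviation qvar :: "int poly" where
  "qvar \<equiv> [:0, 1:]"

abbreviation pvar2 :: "int poly poly" where
  "pvar2 \<equiv> [:0, 1:]"

abbreviation qvar2 :: "int poly poly" where
  "qvar2 \<equiv> [:qvar:]"

definition weight :: "nat list \<Rightarrow> (nat \<times> nat) set \<Rightarrow> int poly poly" where
  "weight lam R = pvar2 ^ card R * qvar2 ^ card (crosses lam R)"

text \<open>The guard is needed because \<open>n - k\<close> is truncated subtraction.\<close>

definition T :: "nat \<Rightarrow> nat \<Rightarrow> nat \<Rightarrow> int poly poly" where
  "T j k n = (if k \<le> n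
     then \<Sum>lam\<in>Par (n - k) k. \<Sum>R\<in>{R \<in> rook_placements lam. card (free_rows lam R) = j}. weight lam R
     else 0)"

lemma finite_Par: "finite (Par a b)"
proof (rule finite_subset)
  show "Par a b \<subseteq> {xs. set xs \<subseteq> {..a} \<and> length xs = b}"
    by (auto simp: Par_def)
  show "finite {xs. set xs \<subseteq> {..a} \<and> length xs = b}"
    by (rule finite_lists_length_eq) simp
qed

lemma finite_cells: "finite (cells lam)"
proof (rule finite_subset)
  show "cells lam \<subseteq> (SIGMA r:{..<length lam}. {..<lam ! r})"
    by (auto simp: cells_def)
qed auto

lemma finite_rook_placements: "finite (rook_placements lam)"
  by (rule finite_subset[of _ "Pow (cells lam)"]) (auto simp: rook_placements_def finite_cells)

text \<open>The divisions below are carried out in \<open>\<int>[q]\<close>. They are exact, see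
  \<open>q_int_exact\<close> and \<open>q_binomial_exact\<close>.\<close>

definition q_int :: "nat \<Rightarrow> int poly" where
  "q_int m = (1 - qvar ^ m) div (1 - qvar)"

definition q_fact :: "nat \<Rightarrow> int poly" where
  "q_fact m = (\<Prod>i=1..m. q_int i)"

definition q_binomial :: "int \<Rightarrow> int \<Rightarrow> int poly" where
  "q_binomial m i = (if 0 \<le> i \<and> i \<le> m
     then q_fact (nat m) div (q_fact (nat i) * q_fact (nat (m - i))) else 0)"

definition binomial_int :: "nat \<Rightarrow> int \<Rightarrow> int" where
  "binomial_int n i = (if 0 \<le> i then int (n choose nat i) else 0)"

lemma one_minus_qvar_nonzero: "1 - qvar \<noteq> 0"
  by (simp add: one_pCons)

lemma q_int_exact: "(1 - qvar) * q_int m = 1 - qvar ^ m"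
proof -
  have "(1 - qvar) dvd (1 - qvar ^ m)"
    unfolding one_diff_power_eq by (rule dvd_triv_left)
  then show ?thesis
    unfolding q_int_def by (rule dvd_mult_div_cancel)
qed

lemma q_int_add: "q_int (i + j) = q_int i + qvar ^ i * q_int j"
proof -
  have "(1 - qvar) * (q_int i + qvar ^ i * q_int j)
      = (1 - qvar) * q_int i + qvar ^ i * ((1 - qvar) * q_int j)"
    by (simp only: algebra_simps)
  also have "\<dots> = 1 - qvar ^ (i + j)"
    by (simp only: q_int_exact power_add right_diff_distrib mult_1_right diff_add_cancel add_diff_eq)
  also have "\<dots> = (1 - qvar) * q_int (i + j)"
    by (simp only: q_int_exact)
  finally show ?thesis
    using one_minus_qvar_nonzero by (metis mult_left_cancel)
qed

lemma q_fact_Suc: "q_fact (Suc m) = q_int (Suc m) * q_fact m"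
  by (simp add: q_fact_def prod.nat_ivl_Suc' mult.commute)

lemma q_fact_mult_dvd: "q_fact i * q_fact j dvd q_fact (i + j)"
proof (induction "i + j" arbitrary: i j)
  case 0
  then show ?case by (simp add: q_fact_def)
next
  case (Suc m)
  show ?case
  proof (cases "i = 0 \<or> j = 0")
    case True
    then show ?thesis by (auto simp: q_fact_def)
  next
    case False
    then obtain a b where ab: "i = Suc a" "j = Suc b"
      by (meson not0_implies_Suc)
    have "q_fact a * q_fact (Suc b) dvd q_fact (a + Suc b)"
      and "q_fact (Suc a) * q_fact b dvd q_fact (Suc a + b)"
      using Suc.hyps(2) unfolding ab by (intro Suc.hyps(1); linarith)+
    then have d: "q_int i * (q_fact a * q_fact j) dvd q_int i * q_fact (Suc (a + b))"
      "q_int j * (q_fact i * q_fact b) dvd q_int j * q_fact (Suc (a + b))"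
      by (simp_all only: ab add_Suc add_Suc_right mult_dvd_mono dvd_refl)
    have e: "q_int i * (q_fact a * q_fact j) = q_fact i * q_fact j"
      "q_int j * (q_fact i * q_fact b) = q_fact i * q_fact j"
      by (simp_all only: ab q_fact_Suc mult_ac)
    have "q_fact (i + j) = q_int (i + j) * q_fact (Suc (a + b))"
      by (simp only: ab add_Suc add_Suc_right q_fact_Suc)
    also have "\<dots> = q_int i * q_fact (Suc (a + b)) + qvar ^ i * (q_int j * q_fact (Suc (a + b)))"
      by (simp only: q_int_add distrib_right mult.assoc)
    finally show ?thesis
      using d unfolding e by (metis dvd_add dvd_mult)
  qed
qed

lemma q_binomial_exact:
  assumes "0 \<le> i" "i \<le> m"
  shows "q_fact (nat i) * q_fact (nat (m - i)) * q_binomial m i = q_fact (nat m)"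
proof -
  have "nat i + nat (m - i) = nat m"
    using assms by simp
  then have "q_fact (nat i) * q_fact (nat (m - i)) dvd q_fact (nat m)"
    using q_fact_mult_dvd[of "nat i" "nat (m - i)"] by simp
  then show ?thesis
    using assms by (simp add: q_binomial_def)
qed

end

theory Submission
  imports Defs
begin

text \<open>
  For \<open>j = 0\<close> every row carries a rook. Read the rows of a shape from the top, shortest row
  first: a row of length \<open>x\<close> with \<open>l\<close> rows above it has exactly \<open>x - l\<close> columns not yet hit by a
  rook, since all rooks above lie in its first \<open>x\<close> columns. Its rook goes into one of these free
  columns, and the crosses of the row are the free columns to the right of the rook. The row
  therefore contributes the factor \<open>p * (1 + q + \<dots> + q ^ (x - l - 1))\<close>, whatever was done above
  (\<open>sum_full_placements\<close>), and this is \<open>1 - q ^ (x - l)\<close> at \<open>p = 1 - q\<close>.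

  Hence \<open>T 0 k n\<close> at \<open>p = 1 - q\<close> is a sum of explicit products over all shapes in a box. Whether or
  not the bottom row fills the width of the box gives a two-term recurrence in the style of Pascal
  (\<open>sum_filling_weight_Suc\<close>). The right-hand side of the theorem obeys the same recurrence
  (\<open>gauss_ballot_sum_Suc\<close>): Pascal's rule for the differences of binomial coefficients reduces it,
  coefficient by coefficient, to the \<open>q\<close>-Pascal rule and an absorption identity. For
  \<open>n < 2 * k\<close> both sides vanish: \<open>k\<close> rooks do not fit into \<open>n - k\<close> columns, and every
  \<open>q\<close>-binomial coefficient has its lower index above the upper one.
\<close>

section \<open>Placements with a rook in every row\<close>

definition full_placements :: "nat list \<Rightarrow> (nat \<times> nat) set set" where
  "full_placements lam = {R \<in> rook_placements lam. free_rows lam R = {}}"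

definition add_bottom_rook :: "nat \<Rightarrow> (nat \<times> nat) set \<Rightarrow> (nat \<times> nat) set" where
  "add_bottom_rook c R = insert (0, c) (map_prod Suc id ` R)"

lemma mem_add_bottom_rook:
  "(r, d) \<in> add_bottom_rook c R \<longleftrightarrow> (case r of 0 \<Rightarrow> d = c | Suc s \<Rightarrow> (s, d) \<in> R)"
  by (cases r) (force simp: add_bottom_rook_def)+

lemma mem_cells_Cons:
  "(r, d) \<in> cells (x # ys) \<longleftrightarrow> (case r of 0 \<Rightarrow> d < x | Suc s \<Rightarrow> (s, d) \<in> cells ys)"
  by (cases r) (auto simp: cells_def)

lemma full_placements_iff:
  "R \<in> full_placements lam \<longleftrightarrow> R \<subseteq> cells lam
     \<and> (\<forall>r<length lam. \<exists>!c. (r, c) \<in> R)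
     \<and> (\<forall>r r' c. (r, c) \<in> R \<longrightarrow> (r', c) \<in> R \<longrightarrow> r = r')"
proof -
  have "r < length lam" if "R \<subseteq> cells lam" "(r, c) \<in> R" for r c
    using that by (auto simp: cells_def)
  then show ?thesis
    unfolding full_placements_def rook_placements_def free_rows_def by blast
qed

lemma finite_full_placements: "finite (full_placements lam)"
  by (simp add: full_placements_def finite_rook_placements)

lemma card_full_placement:
  assumes "R \<in> full_placements lam"
  shows "card R = length lam"
proof -
  have row: "r < length lam" if "(r, c) \<in> R" for r c
    using assms that by (auto simp: full_placements_iff cells_def)
  have ex: "\<exists>!c. (r, c) \<in> R" if "r < length lam" for r
    using assms that by (auto simp: full_placements_iff)
  have "inj_on fst R"
  proof (rule inj_onI)
    fix z w assume "z \<in> R" "w \<in> R" "fst z = fst w"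
    then show "z = w"
      using ex[of "fst z"] row[of "fst z" "snd z"] by (cases z; cases w) auto
  qed
  moreover have "fst ` R = {..<length lam}"
  proof (intro equalityI subsetI)
    fix r assume "r \<in> {..<length lam}"
    then obtain c where "(r, c) \<in> R"
      using ex[of r] by auto
    then show "r \<in> fst ` R"
      by (rule image_eqI[rotated]) simp
  qed (use row in auto)
  ultimately show ?thesis
    by (metis card_image card_lessThan)
qed

lemma card_columns_full_placement:
  assumes "R \<in> full_placements lam"
  shows "card (snd ` R) = length lam"
proof -
  have "inj_on snd R"
    using assms unfolding full_placements_iff inj_on_def by auto
  then show ?thesis
    using assms by (simp add: card_image card_full_placement)
qed

lemma columns_full_placement_subset:
  assumes "R \<in> full_placements lam" and "\<forall>y\<in>set lam. y \<le> x"
  shows "snd ` R \<subseteq> {..<x}"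
proof
  fix c assume "c \<in> snd ` R"
  then obtain r where "(r, c) \<in> cells lam"
    using assms(1) by (auto simp: full_placements_iff)
  then have "r < length lam" and "c < lam ! r"
    by (auto simp: cells_def)
  then show "c \<in> {..<x}"
    using assms(2) nth_mem[of r lam] by (fastforce intro: less_le_trans)
qed

lemma full_placements_Nil: "full_placements [] = {{}}"
  by (auto simp: full_placements_iff cells_def)

lemma add_bottom_rook_full_placement:
  assumes "R \<in> full_placements ys" and "c < x" and "c \<notin> snd ` R"
  shows "add_bottom_rook c R \<in> full_placements (x # ys)"
proof -
  have "add_bottom_rook c R \<subseteq> cells (x # ys)"
    using assms by (auto simp: mem_add_bottom_rook mem_cells_Cons full_placements_iff
        split: nat.splits)
  moreover have "\<exists>!d. (r, d) \<in> add_bottom_rook c R" if "r < length (x # ys)" for r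
    using that assms(1)
    by (cases r) (auto simp: mem_add_bottom_rook full_placements_iff)
  moreover have "r = r'"
    if "(r, d) \<in> add_bottom_rook c R" "(r', d) \<in> add_bottom_rook c R" for r r' d
  proof -
    have "(s, c) \<notin> R" for s
      using assms(3) by force
    moreover have "s = s'" if "(s, d) \<in> R" "(s', d) \<in> R" for s s'
      using assms(1) that unfolding full_placements_iff by blast
    ultimately show ?thesis
      using that by (cases r; cases r') (auto simp: mem_add_bottom_rook)
  qed
  ultimately show ?thesis
    by (simp add: full_placements_iff)
qed

lemma full_placement_Cons_cases:
  assumes "R \<in> full_placements (x # ys)"
  obtains c S where "S \<in> full_placements ys" "c < x" "c \<notin> snd ` S" "R = add_bottom_rook c S"
proof -
  define S where "S = {(r, c). (Suc r, c) \<in> R}"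
  have sub: "R \<subseteq> cells (x # ys)"
    using assms by (simp only: full_placements_iff)
  have ex: "\<exists>!c. (r, c) \<in> R" if "r < Suc (length ys)" for r
    using assms that by (simp only: full_placements_iff list.size add_0_right add_Suc_right)
  have inj: "r = r'" if "(r, c) \<in> R" "(r', c) \<in> R" for r r' c
    using assms that unfolding full_placements_iff by blast
  obtain c where bottom: "\<And>d. (0, d) \<in> R \<longleftrightarrow> d = c"
    using ex[OF zero_less_Suc] by metis
  then have c: "(0, c) \<in> R"
    by simp
  have R: "R = add_bottom_rook c S"
  proof (rule set_eqI)
    fix z :: "nat \<times> nat"
    obtain r d where z: "z = (r, d)" by (cases z)
    show "z \<in> R \<longleftrightarrow> z \<in> add_bottom_rook c S"
      unfolding z mem_add_bottom_rook by (cases r) (simp_all add: bottom S_def)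
  qed
  have "S \<subseteq> cells ys"
  proof
    fix z assume "z \<in> S"
    then obtain r d where z: "z = (r, d)" and "(Suc r, d) \<in> R"
      by (auto simp: S_def)
    then have "(Suc r, d) \<in> cells (x # ys)"
      using sub by blast
    then show "z \<in> cells ys"
      by (simp add: z mem_cells_Cons)
  qed
  moreover have "\<exists>!d. (r, d) \<in> S" if "r < length ys" for r
    using ex[of "Suc r"] that by (simp add: S_def)
  moreover have "r = r'" if "(r, d) \<in> S" "(r', d) \<in> S" for r r' d
    using that inj[of "Suc r" d "Suc r'"] by (simp add: S_def)
  ultimately have "S \<in> full_placements ys"
    by (simp add: full_placements_iff)
  moreover have "(0, c) \<in> cells (x # ys)"
    using c sub by blast
  then have "c < x"
    by (simp add: mem_cells_Cons)
  moreover have "(r, c) \<notin> S" for r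
    using c inj[of 0 c "Suc r"] by (auto simp: S_def)
  then have "c \<notin> snd ` S"
    by auto
  ultimately show ?thesis
    using R by (rule that)
qed

lemma add_bottom_rook_inject:
  "add_bottom_rook c R = add_bottom_rook d S \<longleftrightarrow> c = d \<and> R = S"
proof
  assume eq: "add_bottom_rook c R = add_bottom_rook d S"
  then have "(0, c) \<in> add_bottom_rook d S"
    by (simp add: mem_add_bottom_rook flip: eq)
  moreover have "(r, e) \<in> R \<longleftrightarrow> (r, e) \<in> S" for r e
    using mem_add_bottom_rook[of "Suc r" e c R] mem_add_bottom_rook[of "Suc r" e d S]
    by (simp add: eq)
  ultimately show "c = d \<and> R = S"
    by (simp add: mem_add_bottom_rook set_eq_iff split_paired_All)
qed simp

lemma sum_full_placements_Cons:
  "(\<Sum>R\<in>full_placements (x # ys). f R)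
     = (\<Sum>R\<in>full_placements ys. \<Sum>c\<in>{..<x} - snd ` R. f (add_bottom_rook c R))"
proof -
  let ?D = "SIGMA R:full_placements ys. {..<x} - snd ` R"
  have "bij_betw (\<lambda>(R, c). add_bottom_rook c R) ?D (full_placements (x # ys))"
  proof (rule bij_betwI')
    show "(case z of (R, c) \<Rightarrow> add_bottom_rook c R) = (case z' of (R, c) \<Rightarrow> add_bottom_rook c R)
        \<longleftrightarrow> z = z'" for z z'
      by (cases z; cases z') (auto simp: add_bottom_rook_inject)
    show "(case z of (R, c) \<Rightarrow> add_bottom_rook c R) \<in> full_placements (x # ys)"
      if "z \<in> ?D" for z
      using that by (auto intro: add_bottom_rook_full_placement)
    show "\<exists>z\<in>?D. R = (case z of (R, c) \<Rightarrow> add_bottom_rook c R)"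
      if "R \<in> full_placements (x # ys)" for R
      using that by (rule full_placement_Cons_cases) auto
  qed
  then have "(\<Sum>R\<in>full_placements (x # ys). f R)
      = (\<Sum>z\<in>?D. f (case z of (R, c) \<Rightarrow> add_bottom_rook c R))"
    by (rule sum.reindex_bij_betw[symmetric])
  also have "\<dots> = (\<Sum>R\<in>full_placements ys. \<Sum>c\<in>{..<x} - snd ` R. f (add_bottom_rook c R))"
    by (subst sum.Sigma) (auto simp: finite_full_placements intro!: sum.cong)
  finally show ?thesis .
qed

text \<open>All crosses of the new bottom row lie to the right of its rook, in columns without a rook
  above; in the rows above, nothing changes, since a rook only affects cells below it or to its
  left.\<close>

lemma crosses_add_bottom_rook:
  "crosses (x # ys) (add_bottom_rook c R)
     = map_prod Suc id ` crosses ys R \<union> Pair 0 ` {d \<in> {..<x} - snd ` R. c < d}"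
proof (rule set_eqI)
  fix z :: "nat \<times> nat"
  obtain r d where z: "z = (r, d)" by (cases z)
  show "z \<in> crosses (x # ys) (add_bottom_rook c R)
    \<longleftrightarrow> z \<in> map_prod Suc id ` crosses ys R \<union> Pair 0 ` {d \<in> {..<x} - snd ` R. c < d}"
  proof (cases r)
    case 0
    have "(\<forall>r'>0. (r', d) \<notin> add_bottom_rook c R) \<longleftrightarrow> (\<forall>s. (Suc s, d) \<notin> add_bottom_rook c R)"
      using gr0_conv_Suc by auto
    also have "\<dots> \<longleftrightarrow> d \<notin> snd ` R"
      by (auto simp: mem_add_bottom_rook image_iff Ball_def)
    finally have above: "(\<forall>r'>0. (r', d) \<notin> add_bottom_rook c R) \<longleftrightarrow> d \<notin> snd ` R" .
    have right: "(d \<noteq> c \<and> (\<forall>c'>d. c' \<noteq> c)) \<longleftrightarrow> c < d"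
      by (metis less_irrefl linorder_neqE_nat order_less_asym)
    have "z \<in> crosses (x # ys) (add_bottom_rook c R)
        \<longleftrightarrow> d < x \<and> (\<forall>r'>0. (r', d) \<notin> add_bottom_rook c R) \<and> (d \<noteq> c \<and> (\<forall>c'>d. c' \<noteq> c))"
      unfolding z 0 crosses_def
      using mem_add_bottom_rook[of 0 _ c R] by (simp add: mem_cells_Cons conj_ac)
    also have "\<dots> \<longleftrightarrow> z \<in> Pair 0 ` {d \<in> {..<x} - snd ` R. c < d}"
      unfolding above right z 0 by auto
    also have "\<dots> \<longleftrightarrow> z \<in> map_prod Suc id ` crosses ys R \<union> Pair 0 ` {d \<in> {..<x} - snd ` R. c < d}"
      unfolding z 0 by auto
    finally show ?thesis .
  next
    case (Suc s)
    have "(\<forall>r'>Suc s. (r', d) \<notin> add_bottom_rook c R) \<longleftrightarrow> (\<forall>r'>s. (r', d) \<notin> R)"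
    proof -
      have "(\<forall>r'>Suc s. P r') \<longleftrightarrow> (\<forall>r'>s. P (Suc r'))" for P
        by (auto simp: Suc_less_eq2)
      then show ?thesis
        by (simp add: mem_add_bottom_rook)
    qed
    moreover have "(Suc s, e) \<in> add_bottom_rook c R \<longleftrightarrow> (s, e) \<in> R" for e
      by (simp add: mem_add_bottom_rook)
    ultimately have "z \<in> crosses (x # ys) (add_bottom_rook c R) \<longleftrightarrow> (s, d) \<in> crosses ys R"
      unfolding z Suc crosses_def by (simp add: mem_cells_Cons)
    also have "\<dots> \<longleftrightarrow> z \<in> map_prod Suc id ` crosses ys R"
      unfolding z Suc by force
    also have "\<dots> \<longleftrightarrow> z \<in> map_prod Suc id ` crosses ys R \<union> Pair 0 ` {d \<in> {..<x} - snd ` R. c < d}"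
      unfolding z Suc by blast
    finally show ?thesis .
  qed
qed

lemma finite_crosses: "finite (crosses lam R)"
  by (rule finite_subset[OF _ finite_cells[of lam]]) (auto simp: crosses_def)

lemma card_crosses_add_bottom_rook:
  "card (crosses (x # ys) (add_bottom_rook c R))
     = card (crosses ys R) + card {d \<in> {..<x} - snd ` R. c < d}"
proof -
  have "card (map_prod Suc id ` crosses ys R) = card (crosses ys R)"
    by (rule card_image) (auto simp: inj_on_def)
  moreover have "card (Pair (0::nat) ` {d \<in> {..<x} - snd ` R. c < d})
      = card {d \<in> {..<x} - snd ` R. c < d}"
    by (rule card_image) (auto simp: inj_on_def)
  ultimately show ?thesis
    unfolding crosses_add_bottom_rook
    by (subst card_Un_disjoint) (auto simp: finite_crosses)
qed

text \<open>The number of larger elements takes each value below \<open>card A\<close> exactly once.\<close>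

lemma sum_power_card_greater:
  fixes A :: "'b::linorder set" and q :: "'a::comm_semiring_1"
  assumes "finite A"
  shows "(\<Sum>c\<in>A. q ^ card {d \<in> A. c < d}) = (\<Sum>j<card A. q ^ j)"
  using assms
proof (induction rule: finite_linorder_min_induct)
  case empty
  then show ?case by simp
next
  case (insert b A)
  have "{d \<in> insert b A. b < d} = A"
    using insert.hyps by auto
  moreover have "{d \<in> insert b A. c < d} = {d \<in> A. c < d}" if "c \<in> A" for c
    using that insert.hyps by auto
  ultimately have "(\<Sum>c\<in>A. q ^ card {d \<in> insert b A. c < d}) = (\<Sum>c\<in>A. q ^ card {d \<in> A. c < d})"
    and "card {d \<in> insert b A. b < d} = card A"
    by (auto intro!: sum.cong)
  moreover have "b \<notin> A"
    using insert.hyps by auto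
  ultimately show ?case
    using insert by (simp add: add.commute)
qed

text \<open>The truncated subtraction is harmless on partitions with a full placement, where a row is
  longer than the number of rows above it; on all others it produces the required factor \<open>0\<close>.\<close>

primrec filling_weight :: "'a::comm_semiring_1 \<Rightarrow> 'a \<Rightarrow> nat list \<Rightarrow> 'a" where
  "filling_weight p q [] = 1"
| "filling_weight p q (x # ys) = p * (\<Sum>j<x - length ys. q ^ j) * filling_weight p q ys"

text \<open>Monotonicity of the row lengths makes the number of free columns of a row independent of
  the choices made above it; this is why the sum factorizes.\<close>

lemma sum_full_placements:
  fixes p q :: "'a::comm_semiring_1"
  assumes "sorted_wrt (\<ge>) lam"
  shows "(\<Sum>R\<in>full_placements lam. p ^ card R * q ^ card (crosses lam R)) = filling_weight p q lam"
  using assms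
proof (induction lam)
  case Nil
  then show ?case
    by (simp add: full_placements_Nil crosses_def cells_def)
next
  case (Cons x ys)
  have row: "(\<Sum>c\<in>{..<x} - snd ` R. p ^ card (add_bottom_rook c R)
        * q ^ card (crosses (x # ys) (add_bottom_rook c R)))
      = p * (\<Sum>j<x - length ys. q ^ j) * (p ^ card R * q ^ card (crosses ys R))"
    (is "?L = _") if R: "R \<in> full_placements ys" for R
  proof -
    let ?A = "{..<x} - snd ` R"
    have "snd ` R \<subseteq> {..<x}"
      using R Cons.prems by (intro columns_full_placement_subset) auto
    then have A: "card ?A = x - length ys"
      using R by (simp add: card_Diff_subset finite_subset card_columns_full_placement)
    have "card (add_bottom_rook c R) = Suc (card R)" if "c \<in> ?A" for c
      using that R card_full_placement[OF R]
        card_full_placement[OF add_bottom_rook_full_placement[OF R, of c x]] by simp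
    then have "?L = (\<Sum>c\<in>?A. p * (p ^ card R * q ^ card (crosses ys R)) * q ^ card {d \<in> ?A. c < d})"
      by (intro sum.cong)
        (simp_all only: card_crosses_add_bottom_rook power_add power_Suc mult_ac)
    also have "\<dots> = p * (p ^ card R * q ^ card (crosses ys R)) * (\<Sum>j<x - length ys. q ^ j)"
      by (simp only: sum_distrib_left[symmetric] sum_power_card_greater finite_Diff finite_lessThan A)
    finally show ?thesis
      by (simp only: mult_ac)
  qed
  have "(\<Sum>R\<in>full_placements (x # ys). p ^ card R * q ^ card (crosses (x # ys) R))
      = (\<Sum>R\<in>full_placements ys. p * (\<Sum>j<x - length ys. q ^ j)
          * (p ^ card R * q ^ card (crosses ys R)))"
    unfolding sum_full_placements_Cons by (intro sum.cong refl row)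
  also have "\<dots> = p * (\<Sum>j<x - length ys. q ^ j) * filling_weight p q ys"
    using Cons by (simp only: sum_distrib_left[symmetric] sorted_wrt.simps)
  finally show ?case by simp
qed

section \<open>Summation over the shapes in a box\<close>

lemma Par_0: "Par a 0 = {[]}"
  by (auto simp: Par_def)

lemma Par_no_columns: "Par 0 (Suc b) = (#) 0 ` Par 0 b"
  by (auto simp: Par_def length_Suc_conv image_iff)

lemma Par_Suc_Suc: "Par (Suc a) (Suc b) = Par a (Suc b) \<union> (#) (Suc a) ` Par (Suc a) b"
  by (fastforce simp: Par_def length_Suc_conv image_iff le_Suc_eq)

lemma filling_weight_Cons_specialized:
  fixes q :: "'a::comm_ring_1"
  shows "filling_weight (1 - q) q (x # ys) = (1 - q ^ (x - length ys)) * filling_weight (1 - q) q ys"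
  by (simp add: one_diff_power_eq)

lemma sum_filling_weight_no_columns:
  fixes q :: "'a::comm_ring_1"
  shows "(\<Sum>lam\<in>Par 0 (Suc b). filling_weight (1 - q) q lam) = 0"
  unfolding Par_no_columns by (intro sum.neutral) auto

text \<open>Either the bottom row is shorter than \<open>Suc a\<close>, or it can be removed.\<close>

lemma sum_filling_weight_Suc:
  fixes q :: "'a::comm_ring_1"
  shows "(\<Sum>lam\<in>Par (Suc a) (Suc b). filling_weight (1 - q) q lam)
    = (\<Sum>lam\<in>Par a (Suc b). filling_weight (1 - q) q lam)
      + (1 - q ^ (Suc a - b)) * (\<Sum>lam\<in>Par (Suc a) b. filling_weight (1 - q) q lam)"
proof -
  have "Par a (Suc b) \<inter> (#) (Suc a) ` Par (Suc a) b = {}"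
    by (auto simp: Par_def)
  then have "(\<Sum>lam\<in>Par (Suc a) (Suc b). filling_weight (1 - q) q lam)
      = (\<Sum>lam\<in>Par a (Suc b). filling_weight (1 - q) q lam)
        + (\<Sum>lam\<in>(#) (Suc a) ` Par (Suc a) b. filling_weight (1 - q) q lam)"
    unfolding Par_Suc_Suc by (intro sum.union_disjoint) (auto simp: finite_Par)
  also have "(\<Sum>lam\<in>(#) (Suc a) ` Par (Suc a) b. filling_weight (1 - q) q lam)
      = (\<Sum>lam\<in>Par (Suc a) b. filling_weight (1 - q) q (Suc a # lam))"
    by (subst sum.reindex) (auto simp: inj_on_def)
  also have "\<dots> = (\<Sum>lam\<in>Par (Suc a) b. (1 - q ^ (Suc a - b)) * filling_weight (1 - q) q lam)"
    by (intro sum.cong refl) (auto simp: Par_def filling_weight_Cons_specialized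
        simp del: filling_weight.simps)
  finally show ?thesis
    by (simp only: sum_distrib_left)
qed

lemma poly_T_0:
  assumes "k \<le> n"
  shows "poly (T 0 k n) (1 - qvar) = (\<Sum>lam\<in>Par (n - k) k. filling_weight (1 - qvar) qvar lam)"
proof -
  have "poly (\<Sum>R\<in>{R \<in> rook_placements lam. card (free_rows lam R) = 0}. weight lam R) (1 - qvar)
      = filling_weight (1 - qvar) qvar lam" if "lam \<in> Par (n - k) k" for lam
  proof -
    have "finite (free_rows lam R)" for R
      by (rule finite_subset[of _ "{..<length lam}"]) (auto simp: free_rows_def)
    then have "{R \<in> rook_placements lam. card (free_rows lam R) = 0} = full_placements lam"
      by (auto simp: full_placements_def)
    moreover have "poly (weight lam R) (1 - qvar)
        = (1 - qvar) ^ card R * qvar ^ card (crosses lam R)" for R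
    proof -
      have "poly pvar2 x = x" and "poly qvar2 x = qvar" for x
        by simp_all
      then show ?thesis
        by (simp only: weight_def poly_mult poly_power)
    qed
    ultimately show ?thesis
      using that by (simp only: poly_sum sum_full_placements Par_def mem_Collect_eq)
  qed
  then show ?thesis
    using assms by (simp only: T_def if_True poly_sum cong: sum.cong)
qed

section \<open>Gaussian binomial coefficients\<close>

lemma q_fact_0: "q_fact 0 = 1"
  by (simp add: q_fact_def)

lemma q_int_nonzero: "q_int (Suc m) \<noteq> 0"
proof
  assume "q_int (Suc m) = 0"
  then have "qvar ^ Suc m = 1"
    using q_int_exact[of "Suc m"] by (simp only: mult_zero_right right_minus_eq)
  then have "poly (qvar ^ Suc m) 0 = poly 1 0"
    by (simp only:)
  then show False
    by simp
qed

lemma q_fact_nonzero: "q_fact m \<noteq> 0"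
  by (induction m) (simp_all only: q_fact_0 q_fact_Suc mult_eq_0_iff q_int_nonzero
      one_neq_zero simp_thms not_False_eq_True)

lemma q_binomial_add:
  "q_fact i * q_fact m * q_binomial (int m + int i) (int i) = q_fact (m + i)"
  using q_binomial_exact[of "int i" "int m + int i"] by (simp add: nat_int_add)

lemma q_binomial_self: "q_binomial (int i) (int i) = 1"
  using q_binomial_add[of i 0] q_fact_nonzero[of i] by (simp add: q_fact_0)

lemma q_binomial_0: "q_binomial (int m) 0 = 1"
  using q_binomial_add[of 0 m] q_fact_nonzero[of m] by (simp add: q_fact_0)

text \<open>For \<open>m = 0\<close> the first summand on the right has lower index above the upper one and is
  \<open>0\<close>. Otherwise, clearing factorials leaves the splitting
  \<open>q_int (m + (i + 1)) = q_int m + q ^ m * q_int (i + 1)\<close>.\<close>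

lemma q_binomial_pascal:
  "q_binomial (int m + int (Suc i)) (int (Suc i))
     = q_binomial (int m - 1 + int (Suc i)) (int (Suc i)) + qvar ^ m * q_binomial (int m + int i) (int i)"
proof (cases m)
  case 0
  have "q_binomial (int i) (int (Suc i)) = 0"
    by (simp add: q_binomial_def)
  then show ?thesis
    using q_binomial_self[of "Suc i"] q_binomial_self[of i] 0 by simp
next
  case (Suc m')
  define A where "A = q_binomial (int (Suc m') + int (Suc i)) (int (Suc i))"
  define B where "B = q_binomial (int m' + int (Suc i)) (int (Suc i))"
  define C where "C = q_binomial (int (Suc m') + int i) (int i)"
  define f where "f = q_fact (Suc (m' + i))"
  have A: "q_fact (Suc i) * q_fact (Suc m') * A = q_int (Suc m' + Suc i) * f"
    using q_binomial_add[of "Suc i" "Suc m'"]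
    by (simp only: A_def f_def add_Suc add_Suc_right q_fact_Suc)
  have B: "q_fact (Suc i) * q_fact m' * B = f"
    using q_binomial_add[of "Suc i" m'] by (simp only: B_def f_def add_Suc_right)
  have C: "q_fact i * q_fact (Suc m') * C = f"
    using q_binomial_add[of i "Suc m'"] by (simp only: C_def f_def add_Suc)
  have "q_fact (Suc i) * q_fact (Suc m') * (B + qvar ^ Suc m' * C)
      = q_int (Suc m') * (q_fact (Suc i) * q_fact m' * B)
        + qvar ^ Suc m' * q_int (Suc i) * (q_fact i * q_fact (Suc m') * C)"
    by (simp only: q_fact_Suc distrib_left mult_ac)
  also have "\<dots> = q_int (Suc m' + Suc i) * f"
    unfolding B C q_int_add by (simp only: distrib_right)
  finally have "q_fact (Suc i) * q_fact (Suc m') * A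
      = q_fact (Suc i) * q_fact (Suc m') * (B + qvar ^ Suc m' * C)"
    using A by (simp only:)
  then have "A = B + qvar ^ Suc m' * C"
    by (simp only: mult_cancel_left mult_eq_0_iff q_fact_nonzero simp_thms)
  moreover have "int m - 1 = int m'"
    using Suc by simp
  ultimately show ?thesis
    by (simp only: Suc A_def B_def C_def)
qed

text \<open>Both sides are \<open>1 - q\<close> times \<open>q_fact (m + i + 1) / (q_fact i * q_fact m)\<close>.\<close>

lemma q_binomial_absorption:
  "(1 - qvar ^ Suc m) * q_binomial (int m + 1 + int i) (int i)
     = (1 - qvar ^ Suc (m + i)) * q_binomial (int m + int i) (int i)"
proof -
  define X where "X = q_binomial (int (Suc m) + int i) (int i)"
  define Y where "Y = q_binomial (int m + int i) (int i)"
  have "q_fact i * q_fact m * (q_int (Suc m) * X) = q_fact i * q_fact (Suc m) * X"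
    by (simp only: q_fact_Suc mult_ac)
  also have "\<dots> = q_int (Suc (m + i)) * q_fact (m + i)"
    unfolding X_def q_binomial_add by (simp only: add_Suc q_fact_Suc)
  also have "\<dots> = q_int (Suc (m + i)) * (q_fact i * q_fact m * Y)"
    by (simp only: Y_def q_binomial_add)
  also have "\<dots> = q_fact i * q_fact m * (q_int (Suc (m + i)) * Y)"
    by (simp only: mult_ac)
  finally have "q_int (Suc m) * X = q_int (Suc (m + i)) * Y"
    by (simp only: mult_cancel_left mult_eq_0_iff q_fact_nonzero simp_thms)
  then have "(1 - qvar) * q_int (Suc m) * X = (1 - qvar) * q_int (Suc (m + i)) * Y"
    by (simp only: mult.assoc)
  moreover have "int (Suc m) = int m + 1"
    by simp
  ultimately show ?thesis
    by (simp only: q_int_exact X_def Y_def)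
qed

section \<open>The alternating sum\<close>

text \<open>For \<open>2 * j \<le> n\<close> these are the ballot numbers.\<close>

definition ballot :: "nat \<Rightarrow> int \<Rightarrow> int" where
  "ballot n j = binomial_int n j - binomial_int n (j - 1)"

lemma binomial_int_Suc: "binomial_int (Suc n) j = binomial_int n j + binomial_int n (j - 1)"
proof (cases "j \<le> 0")
  case True
  then show ?thesis
    by (auto simp: binomial_int_def)
next
  case False
  then obtain i where "j = int (Suc i)"
    by (metis not_le zero_less_imp_eq_int gr0_conv_Suc)
  then show ?thesis
    by (simp add: binomial_int_def nat_add_distrib)
qed

lemma ballot_Suc: "ballot (Suc n) j = ballot n j + ballot n (j - 1)"
  by (simp add: ballot_def binomial_int_Suc)

lemma ballot_neg: "j < 0 \<Longrightarrow> ballot n j = 0"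
  by (simp add: ballot_def binomial_int_def)

lemma ballot_middle: "ballot (2 * k + 1) (int k + 1) = 0"
proof -
  have "(2 * k + 1 choose Suc k) = (2 * k + 1 choose k)"
    using binomial_symmetric[of k "2 * k + 1"] by simp
  then show ?thesis
    by (simp add: ballot_def binomial_int_def nat_add_distrib)
qed

definition gauss_sign :: "nat \<Rightarrow> int poly" where
  "gauss_sign i = (-1) ^ i * qvar ^ (i * (i + 1) div 2)"

lemma gauss_sign_0: "gauss_sign 0 = 1"
  by (simp add: gauss_sign_def)

lemma gauss_sign_Suc: "gauss_sign (Suc i) = - (qvar ^ Suc i * gauss_sign i)"
proof -
  have "Suc i * (Suc i + 1) div 2 = Suc i + i * (i + 1) div 2"
    using div_mult_self2[of 2 "i * (i + 1)" "Suc i"] by (simp add: algebra_simps)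
  then show ?thesis
    by (simp only: gauss_sign_def power_add power_Suc mult_minus_left mult_minus_right
        minus_mult_minus mult_1_left mult_ac)
qed

definition gauss_ballot_sum :: "nat \<Rightarrow> nat \<Rightarrow> int poly" where
  "gauss_ballot_sum n k = (\<Sum>i\<le>k. gauss_sign i * q_binomial (int n - 2 * int k + int i) (int i)
     * of_int (ballot n (int k - int i)))"

lemma gauss_ballot_sum_eq_0: "n < 2 * k \<Longrightarrow> gauss_ballot_sum n k = 0"
  unfolding gauss_ballot_sum_def by (intro sum.neutral) (auto simp: q_binomial_def)

lemma gauss_ballot_sum_0: "gauss_ballot_sum n 0 = 1"
  by (simp add: gauss_ballot_sum_def gauss_sign_0 q_binomial_0 ballot_def binomial_int_def)

text \<open>This compares the coefficients of a single \<open>ballot\<close> value in the recurrence for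
  \<open>gauss_ballot_sum\<close>. The \<open>q\<close>-Pascal rule splits the first coefficient on the left into the first
  one on the right and a multiple of the second one on the left; as \<open>gauss_sign (i + 1)\<close> is
  \<open>- q ^ (i + 1) * gauss_sign i\<close>, the two multiples add up to the factor \<open>1 - q ^ (m + i + 1)\<close>,
  which absorption turns into \<open>1 - q ^ (m + 1)\<close>.\<close>

lemma gauss_coefficient_recurrence:
  "gauss_sign (Suc i) * q_binomial (int m + int (Suc i)) (int (Suc i))
     + gauss_sign i * q_binomial (int m + int i) (int i)
   = gauss_sign (Suc i) * q_binomial (int m - 1 + int (Suc i)) (int (Suc i))
     + (1 - qvar ^ Suc m) * (gauss_sign i * q_binomial (int m + 1 + int i) (int i))"
proof -
  define q where "q = qvar"
  define b where "b = q_binomial (int m + int i) (int i)"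
  define B where "B = q_binomial (int m - 1 + int (Suc i)) (int (Suc i))"
  define s where "s = gauss_sign i"
  have "- (q ^ Suc i * s) * (B + q ^ m * b) + s * b = - (q ^ Suc i * s) * B + s * ((1 - q ^ Suc (m + i)) * b)"
    by (simp add: algebra_simps power_add)
  also have "(1 - q ^ Suc (m + i)) * b = (1 - q ^ Suc m) * q_binomial (int m + 1 + int i) (int i)"
    unfolding q_def b_def q_binomial_absorption ..
  finally show ?thesis
    unfolding q_binomial_pascal gauss_sign_Suc q_def b_def B_def s_def by (simp only: mult_ac)
qed

lemma gauss_ballot_sum_Suc:
  assumes "2 * k + 1 \<le> n"
  shows "gauss_ballot_sum (Suc n) (Suc k)
    = gauss_ballot_sum n (Suc k) + (1 - qvar ^ (n - 2 * k)) * gauss_ballot_sum n k"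
proof -
  define m where "m = n - (2 * k + 1)"
  have n: "n = 2 * k + 1 + m"
    using assms by (simp add: m_def)
  define d :: "nat \<Rightarrow> int poly" where "d i = of_int (ballot n (int (Suc k) - int i))" for i
  define e where "e i = gauss_sign i * q_binomial (int m + int i) (int i)" for i
  define f where "f i = gauss_sign i * q_binomial (int m - 1 + int i) (int i)" for i
  define g where "g i = gauss_sign i * q_binomial (int m + 1 + int i) (int i)" for i
  have m1: "int (Suc n) - 2 * int (Suc k) = int m" "int n - 2 * int (Suc k) = int m - 1"
    "int n - 2 * int k = int m + 1" "n - 2 * k = Suc m"
    by (simp_all add: n)
  have d_last: "d (Suc (Suc k)) = 0"
    by (simp add: d_def ballot_neg)
  \<comment> \<open>For \<open>m = 0\<close> the coefficients \<open>e 0 = 1\<close> and \<open>f 0 = 0\<close> differ, but they multiply the difference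
    of the two equal middle binomial coefficients of the odd row \<open>n\<close>.\<close>
  have first: "e 0 * d 0 = f 0 * d 0"
  proof (cases m)
    case 0
    then have "d 0 = 0"
      using ballot_middle[of k] by (simp add: d_def n add.commute)
    then show ?thesis by simp
  next
    case (Suc m')
    then have "int m - 1 = int m'" by simp
    then show ?thesis
      by (simp add: e_def f_def q_binomial_0)
  qed
  have "gauss_ballot_sum (Suc n) (Suc k) = (\<Sum>i\<le>Suc k. e i * (d i + d (Suc i)))"
    unfolding gauss_ballot_sum_def m1 e_def d_def
    by (intro sum.cong refl) (simp add: ballot_Suc algebra_simps)
  also have "\<dots> = (\<Sum>i\<le>Suc k. e i * d i) + (\<Sum>i\<le>Suc k. e i * d (Suc i))"
    by (simp only: distrib_left sum.distrib)
  also have "(\<Sum>i\<le>Suc k. e i * d i) = e 0 * d 0 + (\<Sum>i\<le>k. e (Suc i) * d (Suc i))"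
    by (rule sum.atMost_Suc_shift)
  also have "(\<Sum>i\<le>Suc k. e i * d (Suc i)) = (\<Sum>i\<le>k. e i * d (Suc i))"
    by (simp add: d_last)
  also have "e 0 * d 0 + (\<Sum>i\<le>k. e (Suc i) * d (Suc i)) + (\<Sum>i\<le>k. e i * d (Suc i))
      = f 0 * d 0 + (\<Sum>i\<le>k. (e (Suc i) + e i) * d (Suc i))"
    by (simp only: first distrib_right sum.distrib add.assoc)
  also have "\<dots> = f 0 * d 0 + (\<Sum>i\<le>k. (f (Suc i) + (1 - qvar ^ Suc m) * g i) * d (Suc i))"
    unfolding e_def f_def g_def gauss_coefficient_recurrence ..
  also have "\<dots> = (f 0 * d 0 + (\<Sum>i\<le>k. f (Suc i) * d (Suc i)))
      + (1 - qvar ^ Suc m) * (\<Sum>i\<le>k. g i * d (Suc i))"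
    by (simp only: distrib_right sum.distrib sum_distrib_left add.assoc mult.assoc)
  also have "f 0 * d 0 + (\<Sum>i\<le>k. f (Suc i) * d (Suc i)) = (\<Sum>i\<le>Suc k. f i * d i)"
    by (rule sum.atMost_Suc_shift[symmetric])
  also have "\<dots> = gauss_ballot_sum n (Suc k)"
    unfolding gauss_ballot_sum_def m1 f_def d_def ..
  also have "(\<Sum>i\<le>k. g i * d (Suc i)) = gauss_ballot_sum n k"
    unfolding gauss_ballot_sum_def m1 g_def d_def by simp
  finally show ?thesis
    by (simp only: m1)
qed

text \<open>The half-perimeter is \<open>n = a + k\<close>, so shrinking the box by a column or by a row both lower
  \<open>n\<close> by one, as in \<open>gauss_ballot_sum_Suc\<close>.\<close>

lemma sum_filling_weight_eq_gauss_ballot_sum: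
  "(\<Sum>lam\<in>Par a k. filling_weight (1 - qvar) qvar lam) = gauss_ballot_sum (a + k) k"
proof (induction k arbitrary: a)
  case 0
  show ?case
    by (simp add: Par_0 gauss_ballot_sum_0)
next
  case (Suc k)
  note column = Suc.IH
  show ?case
  proof (induction a)
    case 0
    show ?case
      by (simp only: sum_filling_weight_no_columns gauss_ballot_sum_eq_0)
        (simp add: gauss_ballot_sum_eq_0)
  next
    case (Suc a)
    have eq: "(\<Sum>lam\<in>Par (Suc a) (Suc k). filling_weight (1 - qvar) qvar lam)
        = gauss_ballot_sum (a + Suc k) (Suc k)
          + (1 - qvar ^ (Suc a - k)) * gauss_ballot_sum (Suc a + k) k"
      by (simp only: sum_filling_weight_Suc Suc.IH column)
    show ?case
    proof (cases "k \<le> a")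
      case True
      then have "a + Suc k - 2 * k = Suc a - k" and "2 * k + 1 \<le> a + Suc k"
        by simp_all
      then show ?thesis
        unfolding eq using gauss_ballot_sum_Suc[of k "a + Suc k"] by (simp only: add_Suc add_Suc_right)
    next
      case False
      \<comment> \<open>The box has too few columns; the truncated exponent makes the last summand vanish.\<close>
      then have "Suc a - k = 0" by simp
      with False show ?thesis
        unfolding eq by (simp add: gauss_ballot_sum_eq_0)
    qed
  qed
qed

theorem proposition12:
  fixes k n :: nat
  shows "poly (T 0 k n) (1 - qvar) =
    (\<Sum>i=0..k. (-1) ^ i * qvar ^ (i * (i + 1) div 2)
       * q_binomial (int n - 2 * int k + int i) (int i)
       * of_int (binomial_int n (int k - int i) - binomial_int n (int k - int i - 1)))"
proof -
  have "poly (T 0 k n) (1 - qvar) = gauss_ballot_sum n k"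
  proof (cases "k \<le> n")
    case True
    then show ?thesis
      by (simp only: poly_T_0 sum_filling_weight_eq_gauss_ballot_sum le_add_diff_inverse2)
  next
    case False
    then show ?thesis
      by (simp add: T_def gauss_ballot_sum_eq_0)
  qed
  then show ?thesis
    by (simp only: gauss_ballot_sum_def gauss_sign_def ballot_def atLeast0AtMost)
qed

end
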